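(* Let $m\ge 0$ be an integer, $k\in\mathbb{N}$ with $k\ge 1$, $\lambda,\xi\in\mathbb{C}\setminus\{0\}$, and $x\in\mathbb{C}$. Then $$\lambda^m B_m^{(k)}\left(k+\frac{x}{\lambda}\right) = \sum_{n=0}^m \hat{D}_{n,\xi}^{(k)}(x|\lambda)\, \xi^{-n}\, s_2(m,n).$$
   Context: All identities are of formal power series in $t$, with $(1+\xi t)^a=\sum_{j\ge0}\binom{a}{j}\xi^j t^j$. The twisted $\lambda$-Daehee polynomials of the second kind of order $k$ are defined by $$\left(\frac{\lambda\log(1+\xi t)\,(1+\xi t)^\lambda}{(1+\xi t)^\lambda-1}\right)^k(1+\xi t)^x = \sum_{n=0}^\infty \hat{D}_{n,\xi}^{(k)}(x|\lambda)\frac{t^n}{n!}.$$ The Bernoulli polynomials of order $k$ are defined by $$\left(\frac{t}{e^t-1}\right)^k e^{xt} = \sum_{n=0}^\infty B_n^{(k)}(x)\frac{t^n}{n!}.$$ The Stirling numbers of the second kind $s_2(l,m)$ are given by $(e^t-1)^m = m!\sum_{l=m}^\infty s_2(l,m)\frac{t^l}{l!}$, with $s_2(l,m)=0$ for $m>l$. *)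

theory Defs
  imports
    Complex_Main
    "HOL-Computational_Algebra.Formal_Power_Series"
    "HOL-Combinatorics.Stirling"
begin

definition one_plus_powr :: "complex \<Rightarrow> complex \<Rightarrow> complex fps" where
  "one_plus_powr \<xi> a = fps_binomial a oo (fps_const \<xi> * fps_X)"

lemma one_plus_powr_altdef:
  "one_plus_powr \<xi> a = Abs_fps (\<lambda>j. (a gchoose j) * \<xi> ^ j)"
  by (simp add: one_plus_powr_def fps_eq_iff)

text \<open>
  The parameter \<open>1\<close> of \<^const>\<open>fps_ln\<close> is a scaling factor:
  \<open>fps_ln 1\<close> is the Mercator series of $\log(1 + t)$.
\<close>

definition log_one_plus :: "complex \<Rightarrow> complex fps" where
  "log_one_plus \<xi> = fps_ln 1 oo (fps_const \<xi> * fps_X)"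

text \<open>
  In the quotients of power series below, numerator and denominator both have subdegree 1
  (for \<open>lam\<close> and \<open>\<xi>\<close> nonzero), so that the division of the type \<open>complex fps\<close> is exact.
\<close>

definition daehee2_base :: "complex \<Rightarrow> complex \<Rightarrow> complex fps" where
  "daehee2_base \<xi> lam =
     fps_const lam * log_one_plus \<xi> * one_plus_powr \<xi> lam / (one_plus_powr \<xi> lam - 1)"

definition twisted_daehee2 ::
  "nat \<Rightarrow> complex \<Rightarrow> nat \<Rightarrow> complex \<Rightarrow> complex \<Rightarrow> complex" where
  "twisted_daehee2 k \<xi> n x lam =
     fact n * fps_nth (daehee2_base \<xi> lam ^ k * one_plus_powr \<xi> x) n"

definition bernoulli_order :: "nat \<Rightarrow> nat \<Rightarrow> complex \<Rightarrow> complex" where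
  "bernoulli_order k n x =
     fact n * fps_nth ((fps_X / (fps_exp 1 - 1)) ^ k * fps_exp x) n"

lemma daehee2_base_exact:
  assumes "lam \<noteq> 0" "\<xi> \<noteq> 0"
  shows "daehee2_base \<xi> lam * (one_plus_powr \<xi> lam - 1) =
           fps_const lam * log_one_plus \<xi> * one_plus_powr \<xi> lam"
proof -
  have d1: "fps_nth (one_plus_powr \<xi> lam - 1) 1 \<noteq> 0"
    using assms by (simp add: one_plus_powr_altdef)
  hence nz: "one_plus_powr \<xi> lam - 1 \<noteq> 0"
    by (metis fps_zero_nth)
  have "subdegree (one_plus_powr \<xi> lam - 1) \<le> 1"
    using d1 by (rule subdegree_leI)
  also have le: "1 \<le> subdegree (fps_const lam * log_one_plus \<xi> * one_plus_powr \<xi> lam)"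
  proof (rule subdegree_geI)
    have "fps_nth (fps_const lam * log_one_plus \<xi> * one_plus_powr \<xi> lam) 1 = lam * \<xi>"
      by (simp add: fps_mult_nth log_one_plus_def one_plus_powr_altdef fps_ln_nth)
    thus "fps_const lam * log_one_plus \<xi> * one_plus_powr \<xi> lam \<noteq> 0"
      using assms by (metis fps_zero_nth mult_eq_0_iff)
  qed (simp add: log_one_plus_def)
  finally have "subdegree (one_plus_powr \<xi> lam - 1) \<le>
      subdegree (fps_const lam * log_one_plus \<xi> * one_plus_powr \<xi> lam)" .
  moreover have "fps_const lam * log_one_plus \<xi> * one_plus_powr \<xi> lam \<noteq> 0"
    using le by (metis subdegree_0 not_one_le_zero)
  ultimately have "(one_plus_powr \<xi> lam - 1) dvd
      (fps_const lam * log_one_plus \<xi> * one_plus_powr \<xi> lam)"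
    using nz by (metis fps_dvd_iff)
  thus ?thesis
    unfolding daehee2_base_def by (rule dvd_div_mult_self)
qed

lemma bernoulli_base_exact:
  "(fps_X / (fps_exp 1 - 1)) * (fps_exp 1 - 1) = (fps_X :: complex fps)"
proof -
  have d1: "fps_nth (fps_exp 1 - 1 :: complex fps) 1 \<noteq> 0"
    by simp
  hence nz: "(fps_exp 1 - 1 :: complex fps) \<noteq> 0"
    by (metis fps_zero_nth)
  have "subdegree (fps_exp 1 - 1 :: complex fps) \<le> 1"
    using d1 by (rule subdegree_leI)
  hence "(fps_exp 1 - 1 :: complex fps) dvd fps_X"
    using nz by (subst fps_dvd_iff) auto
  thus ?thesis
    by (rule dvd_div_mult_self)
qed

lemma twisted_daehee2_gf:
  "daehee2_base \<xi> lam ^ k * one_plus_powr \<xi> x =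
     Abs_fps (\<lambda>n. twisted_daehee2 k \<xi> n x lam / fact n)"
  by (simp add: fps_eq_iff twisted_daehee2_def)

lemma bernoulli_order_gf:
  "(fps_X / (fps_exp 1 - 1)) ^ k * fps_exp x =
     Abs_fps (\<lambda>n. bernoulli_order k n x / fact n)"
  by (simp add: fps_eq_iff bernoulli_order_def)

text \<open>
  \<^const>\<open>Stirling\<close> is defined by its recurrence; it has the exponential generating
  function that characterises the Stirling numbers of the second kind.
\<close>

lemma Stirling_gf:
  "(fps_exp 1 - 1) ^ m =
     fps_const (fact m) * Abs_fps (\<lambda>l. of_nat (Stirling l m) / fact l :: complex)"
proof -
  define c where "c = (\<lambda>m. fps_nth ((fps_exp 1 - 1 :: complex fps) ^ m))"
  have rec: "of_nat (Suc l) * c (Suc m) (Suc l) = of_nat (Suc m) * (c (Suc m) l + c m l)" for m l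
  proof -
    have "fps_deriv ((fps_exp 1 - 1 :: complex fps) ^ Suc m) =
            fps_const (of_nat (Suc m)) * ((fps_exp 1 - 1) ^ Suc m + (fps_exp 1 - 1) ^ m)"
      by (subst fps_deriv_power) (simp add: algebra_simps)
    hence "fps_nth (fps_deriv ((fps_exp 1 - 1 :: complex fps) ^ Suc m)) l =
            fps_nth (fps_const (of_nat (Suc m)) * ((fps_exp 1 - 1) ^ Suc m + (fps_exp 1 - 1) ^ m)) l"
      by (rule arg_cong)
    thus ?thesis
      by (simp add: c_def del: power_Suc of_nat_Suc)
  qed
  have "c m l = fact m * (of_nat (Stirling l m) / fact l)" for l
  proof (induction l m rule: Stirling.induct)
    case (4 n k)
    have "of_nat (Suc n) * c (Suc k) (Suc n) =
            of_nat (Suc k) * (fact (Suc k) * of_nat (Stirling n (Suc k)) +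
              fact k * of_nat (Stirling n k)) / fact n"
      unfolding rec 4 by (simp add: field_simps)
    also have "\<dots> = of_nat (Suc n) *
        (fact (Suc k) * (of_nat (Stirling (Suc n) (Suc k)) / fact (Suc n)))"
      by (simp add: divide_simps del: of_nat_Suc) (simp add: algebra_simps)
    finally show ?case
      using of_nat_neq_0 mult_left_cancel by blast
  qed (simp_all add: c_def)
  thus ?thesis
    by (simp add: fps_eq_iff c_def)
qed

end

theory Submission
  imports Defs
begin

text \<open>
  Substitute $t \mapsto (e^t - 1)/\xi$ in the generating function of the Daehee polynomials.
  This turns $(1 + \xi t)^a$ into $e^{at}$ and $\log(1 + \xi t)$ into $t$, so that
  the result is $(\lambda t / (e^{\lambda t} - 1))^k e^{(k\lambda + x)t}$, which is the generating
  function of the Bernoulli polynomials at $k + x/\lambda$ with $t$ scaled by $\lambda$.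
  The powers of $(e^t - 1)/\xi$ contribute the Stirling numbers.
\<close>

text \<open>The binomial series satisfies \<open>(1 + X) * f' = a * f\<close>. Composing with
  \<open>e^t - 1\<close> turns \<open>1 + X\<close> into \<open>e^t\<close>, which is exactly the
  chain rule factor, so the composite solves \<open>g' = a * g\<close> with constant coefficient
  1.\<close>

lemma fps_binomial_compose_exp:
  "fps_binomial a oo (fps_exp 1 - 1) = fps_exp (a :: 'a :: field_char_0)"
proof -
  let ?e = "fps_exp 1 - 1 :: 'a fps"
  have e0: "fps_nth ?e 0 = 0" by simp
  have "fps_deriv (fps_binomial a) * (1 + fps_X) = fps_const a * fps_binomial a"
    by (subst fps_binomial_deriv, rule dvd_div_mult_self) simp
  hence "(fps_deriv (fps_binomial a) * (1 + fps_X)) oo ?e = (fps_const a * fps_binomial a) oo ?e"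
    by simp
  hence "(fps_deriv (fps_binomial a) oo ?e) * fps_exp 1 = fps_const a * (fps_binomial a oo ?e)"
    by (simp add: fps_compose_mult_distrib[OF e0] fps_compose_add_distrib)
  hence "fps_deriv (fps_binomial a oo ?e) = fps_const a * (fps_binomial a oo ?e)"
    by (simp add: fps_compose_deriv[OF e0])
  thus ?thesis
    by (simp add: fps_exp_unique_ODE)
qed

text \<open>Reassociating the composition lets the scalings by \<open>\<xi>\<close> and
  \<open>1 / \<xi>\<close> cancel.\<close>

lemma compose_scale_compose_exp:
  assumes "\<xi> \<noteq> (0 :: 'a :: field_char_0)"
  shows "(f oo (fps_const \<xi> * fps_X)) oo (fps_const (1 / \<xi>) * (fps_exp 1 - 1)) =
           f oo (fps_exp 1 - 1)"
proof -
  let ?u = "fps_const (1 / \<xi>) * (fps_exp 1 - 1)"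
  have u0: "fps_nth ?u 0 = 0" by simp
  have "(fps_const \<xi> * fps_X) oo ?u = fps_exp 1 - 1"
    using assms by (simp add: fps_compose_mult_distrib[OF u0] mult.assoc[symmetric])
  thus ?thesis
    by (simp add: fps_compose_assoc[OF u0, symmetric])
qed

lemma one_plus_powr_compose_exp:
  assumes "\<xi> \<noteq> 0"
  shows "one_plus_powr \<xi> a oo (fps_const (1 / \<xi>) * (fps_exp 1 - 1)) = fps_exp a"
  by (simp only: one_plus_powr_def compose_scale_compose_exp[OF assms] fps_binomial_compose_exp)

lemma log_one_plus_compose_exp:
  assumes "\<xi> \<noteq> 0"
  shows "log_one_plus \<xi> oo (fps_const (1 / \<xi>) * (fps_exp 1 - 1)) = fps_X"
  by (simp only: log_one_plus_def compose_scale_compose_exp[OF assms] fps_ln_fps_exp_inv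
      fps_inv_fps_exp_compose(1) one_neq_zero not_False_eq_True)

text \<open>Composition is not pushed through the quotients. Both sides are multiplied by the
  nonzero series \<open>fps_exp lam - 1\<close>; exactness of the two divisions then reduces each
  product to \<open>lam * t * e^(lam * t)\<close>.\<close>

lemma daehee2_base_compose_exp:
  assumes "lam \<noteq> 0" "\<xi> \<noteq> 0"
  shows "daehee2_base \<xi> lam oo (fps_const (1 / \<xi>) * (fps_exp 1 - 1)) =
           ((fps_X / (fps_exp 1 - 1)) oo (fps_const lam * fps_X)) * fps_exp lam"
    (is "?D = ?B * _")
proof -
  let ?u = "fps_const (1 / \<xi>) * (fps_exp 1 - 1) :: complex fps"
  let ?l = "fps_const lam * fps_X :: complex fps"
  have u0: "fps_nth ?u 0 = 0" and l0: "fps_nth ?l 0 = 0" by simp_all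
  have "fps_nth (fps_exp lam - 1) 1 \<noteq> 0"
    using assms by simp
  hence nz: "fps_exp lam - 1 \<noteq> 0"
    by (metis fps_zero_nth)
  have "?D * (fps_exp lam - 1) = (daehee2_base \<xi> lam * (one_plus_powr \<xi> lam - 1)) oo ?u"
    by (simp only: fps_compose_mult_distrib[OF u0] fps_compose_sub_distrib fps_compose_1
        one_plus_powr_compose_exp[OF assms(2)])
  also have "\<dots> = ?l * fps_exp lam"
    by (simp only: daehee2_base_exact[OF assms] fps_compose_mult_distrib[OF u0] fps_const_compose
        one_plus_powr_compose_exp[OF assms(2)] log_one_plus_compose_exp[OF assms(2)])
  also have "?l = ((fps_X / (fps_exp 1 - 1)) * (fps_exp 1 - 1)) oo ?l"
    by (simp add: bernoulli_base_exact)
  also have "\<dots> = ?B * (fps_exp lam - 1)"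
    by (simp only: fps_compose_mult_distrib[OF l0] fps_compose_sub_distrib fps_compose_1
        fps_exp_compose_linear mult_1_right)
  finally have "?D * (fps_exp lam - 1) = (?B * fps_exp lam) * (fps_exp lam - 1)"
    by (simp add: mult_ac)
  thus ?thesis
    using nz by simp
qed

lemma daehee2_gf_compose_exp:
  assumes "lam \<noteq> 0" "\<xi> \<noteq> 0"
  shows "(daehee2_base \<xi> lam ^ k * one_plus_powr \<xi> x) oo (fps_const (1 / \<xi>) * (fps_exp 1 - 1)) =
           ((fps_X / (fps_exp 1 - 1)) ^ k * fps_exp (of_nat k + x / lam)) oo (fps_const lam * fps_X)"
proof -
  let ?u = "fps_const (1 / \<xi>) * (fps_exp 1 - 1) :: complex fps"
  let ?l = "fps_const lam * fps_X :: complex fps"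
  have u0: "fps_nth ?u 0 = 0" and l0: "fps_nth ?l 0 = 0" by simp_all
  \<comment> \<open>The shift by \<open>k\<close> in the Bernoulli argument collects the factor
    \<open>fps_exp lam\<close> from each of the \<open>k\<close> copies of the base.\<close>
  have "lam * (of_nat k + x / lam) = of_nat k * lam + x"
    using assms by (simp add: field_simps)
  hence exp: "fps_exp (lam * (of_nat k + x / lam)) = fps_exp lam ^ k * fps_exp x"
    by (simp only: fps_exp_add_mult fps_exp_power_mult)
  show ?thesis
    by (simp only: fps_compose_mult_distrib[OF u0] fps_compose_mult_distrib[OF l0]
        fps_compose_power[OF u0, symmetric] fps_compose_power[OF l0, symmetric]
        daehee2_base_compose_exp[OF assms] one_plus_powr_compose_exp[OF assms(2)]
        fps_exp_compose_linear exp power_mult_distrib mult.assoc)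
qed

theorem theorem4p5:
  fixes m k :: nat and lam \<xi> x :: complex
  assumes "k \<ge> 1" and "lam \<noteq> 0" and "\<xi> \<noteq> 0"
  shows "lam ^ m * bernoulli_order k m (of_nat k + x / lam) =
         (\<Sum>n=0..m. twisted_daehee2 k \<xi> n x lam * \<xi> powi (- int n) * of_nat (Stirling m n))"
proof -
  let ?F = "daehee2_base \<xi> lam ^ k * one_plus_powr \<xi> x"
  let ?u = "fps_const (1 / \<xi>) * (fps_exp 1 - 1) :: complex fps"
  \<comment> \<open>The \<open>fact n\<close> here turns the \<open>n\<close>-th coefficient of
    \<open>?F\<close> into a Daehee value, and \<open>1 / fact m\<close> cancels the outer
    \<open>fact m\<close>.\<close>
  have u_power: "fps_nth (?u ^ n) m = \<xi> powi (- int n) * (fact n * of_nat (Stirling m n) / fact m)" for n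
    by (simp only: power_mult_distrib Stirling_gf fps_const_power)
      (simp add: power_int_minus power_one_over inverse_eq_divide)
  \<comment> \<open>Replacing \<open>t\<close> by \<open>lam * t\<close> multiplies the
    \<open>m\<close>-th coefficient by \<open>lam ^ m\<close>.\<close>
  have "lam ^ m * bernoulli_order k m (of_nat k + x / lam) = fact m * fps_nth (?F oo ?u) m"
    by (simp add: daehee2_gf_compose_exp[OF assms(2,3)] bernoulli_order_def)
  also have "\<dots> = (\<Sum>n=0..m. fact m * (fps_nth ?F n * fps_nth (?u ^ n) m))"
    by (simp only: fps_compose_nth sum_distrib_left)
  also have "\<dots> = (\<Sum>n=0..m. twisted_daehee2 k \<xi> n x lam * \<xi> powi (- int n) * of_nat (Stirling m n))"
    by (intro sum.cong refl) (simp only: u_power, simp add: twisted_daehee2_def)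
  finally show ?thesis .
qed

end
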